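(* Let $V$ be an isometry and $W$ a co-isometry on a complex separable Hilbert space $\mathcal{H}$. If the pair $(V,W)$ is twisted, then the pair $(V,W)$ is doubly twisted.
   Context: Operators are bounded linear operators. A co-isometry is an operator whose adjoint is an isometry. A pair $(T_1,T_2)$ of operators on $\mathcal{H}$ is called twisted with respect to a unitary operator $U$ on $\mathcal{H}$ (a twist) if $T_1T_2=UT_2T_1$ and $T_iU=UT_i$ for $i=1,2$; it is called doubly twisted with respect to $U$ if in addition $T_1^*T_2=U^*T_2T_1^*$. A pair is called twisted (respectively doubly twisted) if it is so with respect to some twist. *)

theory Defs
  imports "HOL-Analysis.Analysis"
begin

text \<open>
  Complex inner product spaces, modelled on the class \<open>real_inner\<close>. The inner product is linear in
  its first argument. The real normed structure is forced by the complex one: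
  \<open>scaleR\<close> is the restriction of \<open>scaleC\<close> to real scalars, and the norm is
  the one induced by \<open>cinner\<close>.
\<close>

class complex_inner = real_normed_vector +
  fixes scaleC :: "complex \<Rightarrow> 'a \<Rightarrow> 'a"  (infixr \<open>*\<^sub>C\<close> 75)
    and cinner :: "'a \<Rightarrow> 'a \<Rightarrow> complex"
  assumes scaleC_add_right: "a *\<^sub>C (x + y) = a *\<^sub>C x + a *\<^sub>C y"
    and scaleC_add_left: "(a + b) *\<^sub>C x = a *\<^sub>C x + b *\<^sub>C x"
    and scaleC_scaleC: "a *\<^sub>C b *\<^sub>C x = (a * b) *\<^sub>C x"
    and scaleC_of_real: "complex_of_real r *\<^sub>C x = r *\<^sub>R x"
    and cinner_commute: "cinner x y = cnj (cinner y x)"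
    and cinner_add_left: "cinner (x + y) z = cinner x z + cinner y z"
    and cinner_scaleC_left: "cinner (a *\<^sub>C x) y = a * cinner x y"
    and cinner_ge_zero: "0 \<le> Re (cinner x x)"
    and cinner_eq_zero_iff: "cinner x x = 0 \<longleftrightarrow> x = 0"
    and norm_eq_sqrt_cinner: "norm x = sqrt (Re (cinner x x))"

class complex_hilbert = complex_inner + complete_space

instantiation complex :: complex_hilbert
begin

definition scaleC_complex :: "complex \<Rightarrow> complex \<Rightarrow> complex" where
  "scaleC_complex a x = a * x"

definition cinner_complex :: "complex \<Rightarrow> complex \<Rightarrow> complex" where
  "cinner_complex x y = x * cnj y"

instance
proof
  fix x :: complex
  show "norm x = sqrt (Re (cinner x x))"
    by (simp add: cinner_complex_def cmod_def power2_eq_square)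
qed (simp_all add: scaleC_complex_def cinner_complex_def algebra_simps scaleR_conv_of_real)

end

definition bounded_op :: "('a::complex_inner \<Rightarrow> 'a) \<Rightarrow> bool" where
  "bounded_op T \<longleftrightarrow> bounded_linear T \<and> (\<forall>c x. T (c *\<^sub>C x) = c *\<^sub>C T x)"

text \<open>
  The following is the Hilbert space adjoint; for bounded operators on a complete space
  it exists by the Riesz representation theorem.
\<close>

definition cadjoint :: "('a::complex_inner \<Rightarrow> 'a) \<Rightarrow> 'a \<Rightarrow> 'a" where
  "cadjoint T = (THE S. \<forall>x y. cinner (T x) y = cinner x (S y))"

lemma cinner_right_cancel:
  assumes "\<And>x. cinner x a = cinner x b"
  shows "a = b"
proof -
  have sum: "cinner ((a - b) + b) z = cinner (a - b) z + cinner b z" for z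
    by (rule cinner_add_left)
  have "cinner a z = cinner b z" for z
    by (simp add: assms cinner_commute[of a z] cinner_commute[of b z])
  then have "cinner (a - b) (a - b) = 0"
    using sum[of "a - b"] by simp
  then show ?thesis
    by (simp add: cinner_eq_zero_iff)
qed

lemma cadjoint_eqI:
  assumes "\<And>x y. cinner (T x) y = cinner x (S y)"
  shows "cadjoint T = S"
  unfolding cadjoint_def
proof (rule the_equality)
  show "\<forall>x y. cinner (T x) y = cinner x (S y)"
    using assms by blast
next
  fix S' assume "\<forall>x y. cinner (T x) y = cinner x (S' y)"
  then have "cinner x (S' y) = cinner x (S y)" for x y
    by (metis assms)
  then show "S' = S"
    by (simp add: cinner_right_cancel fun_eq_iff)
qed

definition isometry_op :: "('a::complex_inner \<Rightarrow> 'a) \<Rightarrow> bool" where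
  "isometry_op V \<longleftrightarrow> bounded_op V \<and> (\<forall>x. norm (V x) = norm x)"

definition coisometry_op :: "('a::complex_inner \<Rightarrow> 'a) \<Rightarrow> bool" where
  "coisometry_op W \<longleftrightarrow> bounded_op W \<and> isometry_op (cadjoint W)"

definition unitary_op :: "('a::complex_inner \<Rightarrow> 'a) \<Rightarrow> bool" where
  "unitary_op U \<longleftrightarrow> bounded_op U \<and> cadjoint U \<circ> U = id \<and> U \<circ> cadjoint U = id"

definition twisted_wrt ::
    "('a::complex_inner \<Rightarrow> 'a) \<Rightarrow> ('a \<Rightarrow> 'a) \<Rightarrow> ('a \<Rightarrow> 'a) \<Rightarrow> bool" where
  "twisted_wrt U T1 T2 \<longleftrightarrow>
     unitary_op U \<and> bounded_op T1 \<and> bounded_op T2 \<and>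
     T1 \<circ> T2 = U \<circ> T2 \<circ> T1 \<and> T1 \<circ> U = U \<circ> T1 \<and> T2 \<circ> U = U \<circ> T2"

definition doubly_twisted_wrt ::
    "('a::complex_inner \<Rightarrow> 'a) \<Rightarrow> ('a \<Rightarrow> 'a) \<Rightarrow> ('a \<Rightarrow> 'a) \<Rightarrow> bool" where
  "doubly_twisted_wrt U T1 T2 \<longleftrightarrow>
     twisted_wrt U T1 T2 \<and> cadjoint T1 \<circ> T2 = cadjoint U \<circ> T2 \<circ> cadjoint T1"

definition twisted :: "('a::complex_inner \<Rightarrow> 'a) \<Rightarrow> ('a \<Rightarrow> 'a) \<Rightarrow> bool" where
  "twisted T1 T2 \<longleftrightarrow> (\<exists>U. twisted_wrt U T1 T2)"

definition doubly_twisted :: "('a::complex_inner \<Rightarrow> 'a) \<Rightarrow> ('a \<Rightarrow> 'a) \<Rightarrow> bool" where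
  "doubly_twisted T1 T2 \<longleftrightarrow> (\<exists>U. doubly_twisted_wrt U T1 T2)"

end

theory Submission
  imports Defs
begin

text \<open>
  Write \<open>V*\<close>, \<open>W*\<close>, \<open>U*\<close> for the adjoints and let \<open>V W = U W V\<close>, where the unitary \<open>U\<close> commutes
  with \<open>V\<close> and \<open>W\<close>. The twist that makes the pair twisted also makes it doubly twisted.
  Since \<open>W W* = 1\<close>, multiplying the relation by \<open>W*\<close> on the right gives \<open>V = U W (V W*)\<close>. Now \<open>V\<close>,
  \<open>V W*\<close> and \<open>U\<close> are all isometric, so \<open>W\<close> preserves the norm of every vector \<open>V W* x\<close>. A
  co-isometry is a partial isometry, and \<open>W* W\<close> fixes each vector whose norm \<open>W\<close> preserves
  (\<open>cadjoint_apply_eq_of_norm_eq\<close>). Hence \<open>V W* = W* (W V W*) = W* U* V\<close>, and taking adjoints,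
  \<open>W V* = V* U W = U V* W\<close>, which is the remaining relation \<open>V* W = U* W V*\<close>.

  The analytic input is that adjoints exist, so that the definite description in
  \<^const>\<open>cadjoint\<close> denotes. This is the Riesz representation theorem, where completeness is used;
  it is obtained for the real inner product \<open>Re (cinner x y)\<close> by minimising
  \<open>(norm x)\<^sup>2 - 2 g x\<close>, and passes to complex functionals since these are determined by their real
  parts.
\<close>

section \<open>The real part of the inner product\<close>

lemma cinner_add_right: "cinner x (y + z) = cinner x y + cinner x z"
  for x y z :: "'a::complex_inner"
  by (metis cinner_add_left cinner_commute complex_cnj_add)

lemma Re_cinner_commute: "Re (cinner x y) = Re (cinner y x)"
  for x y :: "'a::complex_inner"
  by (metis cinner_commute complex_cnj(1) complex.sel(1) complex.collapse)

lemma Re_cinner_scaleR_left: "Re (cinner (r *\<^sub>R x) y) = r * Re (cinner x y)"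
  for x y :: "'a::complex_inner"
  by (simp flip: scaleC_of_real add: cinner_scaleC_left)

lemma power2_norm_eq_Re_cinner: "(norm x)\<^sup>2 = Re (cinner x x)"
  for x :: "'a::complex_inner"
  by (simp add: norm_eq_sqrt_cinner cinner_ge_zero)

lemma power2_norm_add: "(norm (x + y))\<^sup>2 = (norm x)\<^sup>2 + 2 * Re (cinner x y) + (norm y)\<^sup>2"
  for x y :: "'a::complex_inner"
  using Re_cinner_commute[of x y]
  by (simp add: power2_norm_eq_Re_cinner cinner_add_left cinner_add_right)

lemma power2_norm_diff: "(norm (x - y))\<^sup>2 = (norm x)\<^sup>2 - 2 * Re (cinner x y) + (norm y)\<^sup>2"
  for x y :: "'a::complex_inner"
proof -
  have "Re (cinner x (- y)) = - Re (cinner x y)"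
    using Re_cinner_scaleR_left[of "- 1" y x] by (metis Re_cinner_commute mult_minus1 scaleR_minus1_left)
  then show ?thesis
    using power2_norm_add[of x "- y"] by simp
qed

lemma Re_cinner_right_cancel:
  fixes a b :: "'a::complex_inner"
  assumes "\<And>x. Re (cinner x a) = Re (cinner x b)"
  shows "a = b"
proof -
  have "(norm (a - b))\<^sup>2 = 0"
    using assms[of a] assms[of b] Re_cinner_commute[of a b]
    by (subst power2_norm_diff) (simp add: power2_norm_eq_Re_cinner)
  then show ?thesis
    by simp
qed

text \<open>
  As the norm is given together with its triangle inequality, the Cauchy--Schwarz inequality is
  read off from the expansion of \<open>(norm (x + y))\<^sup>2\<close>.
\<close>

lemma Re_cinner_le_norm: "Re (cinner x y) \<le> norm x * norm y"
  for x y :: "'a::complex_inner"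
proof -
  have "(norm (x + y))\<^sup>2 \<le> (norm x + norm y)\<^sup>2"
    by (simp add: norm_triangle_ineq power_mono)
  then show ?thesis
    by (simp add: power2_norm_add power2_sum)
qed

lemma bounded_linear_Re_cinner_left: "bounded_linear (\<lambda>x. Re (cinner x y))"
  for y :: "'a::complex_inner"
proof (rule bounded_linear_intro[where K = "norm y"])
  fix x :: 'a
  show "norm (Re (cinner x y)) \<le> norm x * norm y"
    using Re_cinner_le_norm[of x y] Re_cinner_le_norm[of "- x" y]
      Re_cinner_scaleR_left[of "- 1" x y]
    by simp
qed (simp_all add: cinner_add_left Re_cinner_scaleR_left)

section \<open>Riesz representation and existence of adjoints\<close>

text \<open>
  The functional \<open>J x = (norm x)\<^sup>2 - 2 g x\<close> equals \<open>(norm (x - u))\<^sup>2 - (norm u)\<^sup>2\<close> once \<open>u\<close> represents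
  \<open>g\<close>, so \<open>u\<close> has to be its minimiser. By the parallelogram law, \<open>J\<close> is uniformly convex,
  which makes minimising sequences Cauchy.
\<close>

lemma Riesz_representation_Re:
  fixes g :: "'a::complex_hilbert \<Rightarrow> real"
  assumes g: "bounded_linear g"
  obtains u where "\<And>x. g x = Re (cinner x u)"
proof -
  interpret g: bounded_linear g by (fact g)
  define J where "J x = (norm x)\<^sup>2 - 2 * g x" for x
  define m where "m = Inf (range J)"
  obtain K where K: "\<And>x. norm (g x) \<le> norm x * K"
    using g.bounded by blast
  have "- K\<^sup>2 \<le> J x" for x
  proof -
    have "g x \<le> norm x * K"
      using K[of x] by simp
    moreover have "0 \<le> (norm x - K)\<^sup>2"
      by simp
    ultimately show ?thesis
      by (simp add: J_def power2_diff)
  qed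
  then have bdd: "bdd_below (range J)"
    by (rule bdd_belowI2)
  have m_le: "m \<le> J x" for x
    unfolding m_def using bdd by (simp add: cInf_lower)
  have "\<exists>x. J x < m + 1 / real (Suc n)" for n
    using cInf_lessD[of "range J" "m + 1 / real (Suc n)"] by (auto simp: m_def)
  then obtain X where X: "\<And>n. J (X n) < m + 1 / real (Suc n)"
    by metis
  have gap: "(norm (x - y))\<^sup>2 \<le> 2 * (J x - m) + 2 * (J y - m)" for x y
  proof -
    have "J ((1/2) *\<^sub>R (x + y)) = (norm (x + y))\<^sup>2 / 4 - g x - g y"
      by (simp add: J_def g.scaleR g.add power_divide add_divide_distrib)
    then have "(norm (x - y))\<^sup>2 = 2 * J x + 2 * J y - 4 * J ((1/2) *\<^sub>R (x + y))"
      using power2_norm_add[of x y] power2_norm_diff[of x y]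
      by (simp add: J_def[of x] J_def[of y] add_divide_distrib)
    then show ?thesis
      using m_le[of "(1/2) *\<^sub>R (x + y)"] by simp
  qed
  have "Cauchy X"
  proof (rule metric_CauchyI)
    fix e :: real
    assume e: "0 < e"
    then obtain N where N: "1 / real (Suc N) < e\<^sup>2 / 4"
      by (metis nat_approx_posE zero_less_divide_iff zero_less_numeral zero_less_power)
    have near: "4 * (J (X n) - m) < e\<^sup>2" if "N \<le> n" for n
    proof -
      have "1 / real (Suc n) \<le> 1 / real (Suc N)"
        using that by (simp add: frac_le)
      then show ?thesis
        using X[of n] N by simp
    qed
    have "dist (X i) (X j) < e" if "N \<le> i" "N \<le> j" for i j
    proof -
      have "(norm (X i - X j))\<^sup>2 < e\<^sup>2"
        using gap[of "X i" "X j"] near[OF that(1)] near[OF that(2)] by simp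
      then show ?thesis
        using e by (simp add: dist_norm power2_less_imp_less)
    qed
    then show "\<exists>N. \<forall>i\<ge>N. \<forall>j\<ge>N. dist (X i) (X j) < e"
      by blast
  qed
  then obtain u where u: "X \<longlonglongrightarrow> u"
    using Cauchy_convergent convergent_def by blast
  have "(\<lambda>n. J (X n)) \<longlonglongrightarrow> J u"
    unfolding J_def by (intro tendsto_intros g.tendsto u)
  moreover have "(\<lambda>n. m + 1 / real (Suc n)) \<longlonglongrightarrow> m + 0"
    by (intro tendsto_intros LIMSEQ_inverse_real_of_nat[unfolded inverse_eq_divide])
  ultimately have "J u \<le> m + 0"
    by (rule LIMSEQ_le) (use X in \<open>force intro: less_imp_le\<close>)
  then have min: "J u \<le> J x" for x
    using m_le[of x] by linarith
  have "g x = Re (cinner x u)" for x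
  proof -
    define c where "c = Re (cinner x u) - g x"
    \<comment> \<open>\<open>t \<mapsto> J (u + t x) - J u = 2 c t + (norm x)\<^sup>2 t\<^sup>2\<close> is nonnegative, so its linear term
      vanishes; the value of \<open>t\<close> below makes it negative when \<open>c \<noteq> 0\<close>, also for \<open>x = 0\<close>.\<close>
    define t where "t = - c / ((norm x)\<^sup>2 + 1)"
    have pos: "0 < (norm x)\<^sup>2 + 1"
      by (simp add: add_nonneg_pos)
    have "J (t *\<^sub>R x + u) - J u = t\<^sup>2 * (norm x)\<^sup>2 + 2 * t * c"
      by (simp add: J_def c_def power2_norm_add Re_cinner_commute[of u "t *\<^sub>R x"]
          Re_cinner_scaleR_left g.add g.scaleR
          power_mult_distrib algebra_simps)
    then have "0 \<le> t\<^sup>2 * (norm x)\<^sup>2 + 2 * t * c"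
      using min[of "t *\<^sub>R x + u"] by simp
    moreover have "c = - t * ((norm x)\<^sup>2 + 1)"
      using pos by (simp add: t_def)
    ultimately have "0 \<le> - (t\<^sup>2 * ((norm x)\<^sup>2 + 2))"
      by (simp add: algebra_simps power2_eq_square)
    then have "t = 0"
      by (smt (verit) mult_pos_pos zero_le_power2 zero_less_power2)
    then show ?thesis
      using pos by (simp add: t_def c_def)
  qed
  then show ?thesis
    using that by blast
qed

text \<open>
  A complex functional \<open>f\<close> satisfies \<open>Im (f x) = - Re (f (\<i> x))\<close>, so two of them agree as soon as
  their real parts do; hence representing the real part suffices.
\<close>

lemma cinner_cadjoint:
  fixes T :: "'a::complex_hilbert \<Rightarrow> 'a"
  assumes "bounded_op T"
  shows "cinner (T x) y = cinner x (cadjoint T y)"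
proof -
  have T: "bounded_linear T" and T_scaleC: "\<And>c x. T (c *\<^sub>C x) = c *\<^sub>C T x"
    using assms by (auto simp: bounded_op_def)
  have "\<exists>u. \<forall>x. cinner (T x) y = cinner x u" for y
  proof -
    obtain u where u: "\<And>x. Re (cinner (T x) y) = Re (cinner x u)"
      using Riesz_representation_Re[OF bounded_linear_compose[OF bounded_linear_Re_cinner_left T]]
      by blast
    have "Im (cinner (T x) y) = Im (cinner x u)" for x
      using u[of "\<i> *\<^sub>C x"] by (simp add: T_scaleC cinner_scaleC_left)
    with u show ?thesis
      by (auto simp: complex_eq_iff)
  qed
  then obtain S where S: "\<And>x y. cinner (T x) y = cinner x (S y)"
    by metis
  then show ?thesis
    by (simp add: cadjoint_eqI)
qed

lemma cinner_cadjoint_left: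
  fixes T :: "'a::complex_hilbert \<Rightarrow> 'a"
  assumes "bounded_op T"
  shows "cinner (cadjoint T x) y = cinner x (T y)"
  by (metis assms cinner_cadjoint cinner_commute)

section \<open>Isometries, co-isometries and unitaries\<close>

lemma Re_cinner_isometry:
  assumes "isometry_op S"
  shows "Re (cinner (S x) (S y)) = Re (cinner x y)"
proof -
  have "S (x + y) = S x + S y"
    using assms by (simp add: isometry_op_def bounded_op_def bounded_linear.linear linear_add)
  then have "(norm (S x + S y))\<^sup>2 = (norm (x + y))\<^sup>2"
    using assms by (metis isometry_op_def)
  then show ?thesis
    using assms by (simp add: power2_norm_add isometry_op_def)
qed

lemma coisometry_cadjoint_right_inverse:
  fixes W :: "'a::complex_hilbert \<Rightarrow> 'a"
  assumes "coisometry_op W"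
  shows "W (cadjoint W x) = x"
proof (rule Re_cinner_right_cancel)
  fix z
  show "Re (cinner z (W (cadjoint W x))) = Re (cinner z x)"
    using assms
    by (simp add: coisometry_op_def Re_cinner_isometry flip: cinner_cadjoint_left)
qed

text \<open>
  For a co-isometry, \<open>W* W\<close> is the orthogonal projection onto the initial space of \<open>W\<close>,
  which is exactly the set of vectors whose norm \<open>W\<close> preserves.
\<close>

lemma cadjoint_apply_eq_of_norm_eq:
  fixes W :: "'a::complex_hilbert \<Rightarrow> 'a"
  assumes W: "coisometry_op W" and norm_eq: "norm (W z) = norm z"
  shows "cadjoint W (W z) = z"
proof -
  have "norm (cadjoint W (W z)) = norm z"
    using W norm_eq by (simp add: coisometry_op_def isometry_op_def)
  moreover have "Re (cinner (cadjoint W (W z)) z) = (norm z)\<^sup>2"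
    using W norm_eq
    by (simp add: coisometry_op_def cinner_cadjoint_left flip: power2_norm_eq_Re_cinner)
  ultimately have "(norm (cadjoint W (W z) - z))\<^sup>2 = 0"
    by (simp add: power2_norm_diff)
  then show ?thesis
    by simp
qed

lemma norm_unitary:
  fixes U :: "'a::complex_hilbert \<Rightarrow> 'a"
  assumes "unitary_op U"
  shows "norm (U x) = norm x"
proof -
  have "bounded_op U" "cadjoint U (U x) = x"
    using assms by (auto simp: unitary_op_def fun_eq_iff)
  then show ?thesis
    by (simp add: norm_eq_sqrt_cinner cinner_cadjoint)
qed

lemma cadjoint_commute_unitary:
  fixes U V :: "'a::complex_hilbert \<Rightarrow> 'a"
  assumes U: "unitary_op U" and V: "bounded_op V" and VU: "\<And>x. V (U x) = U (V x)"
  shows "cadjoint V (U x) = U (cadjoint V x)"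
proof (rule cinner_right_cancel)
  fix z
  have bU: "bounded_op U"
    and left_inv: "\<And>x. cadjoint U (U x) = x" and right_inv: "\<And>x. U (cadjoint U x) = x"
    using U by (auto simp: unitary_op_def fun_eq_iff)
  have "cadjoint U (V z) = V (cadjoint U z)"
    by (metis VU left_inv right_inv)
  then show "cinner z (cadjoint V (U x)) = cinner z (U (cadjoint V x))"
    by (metis bU V cinner_cadjoint cinner_cadjoint_left)
qed

section \<open>Twisted pairs of an isometry and a co-isometry\<close>

lemma twisted_wrt_imp_doubly_twisted_wrt:
  fixes U V W :: "'a::complex_hilbert \<Rightarrow> 'a"
  assumes V: "isometry_op V" and W: "coisometry_op W" and tw: "twisted_wrt U V W"
  shows "doubly_twisted_wrt U V W"
proof -
  have U: "unitary_op U" and bV: "bounded_op V" and bW: "bounded_op W"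
    using tw by (auto simp: twisted_wrt_def)
  have bU: "bounded_op U" and left_inv: "\<And>x. cadjoint U (U x) = x"
    using U by (auto simp: unitary_op_def fun_eq_iff)
  have VW: "\<And>x. V (W x) = U (W (V x))" and VU: "\<And>x. V (U x) = U (V x)"
    using tw by (auto simp: twisted_wrt_def fun_eq_iff)
  have key: "V (cadjoint W x) = cadjoint W (cadjoint U (V x))" for x
  proof -
    let ?z = "V (cadjoint W x)"
    have UWz: "U (W ?z) = V x"
      by (simp add: coisometry_cadjoint_right_inverse[OF W] flip: VW)
    have "norm (W ?z) = norm ?z"
      using V W UWz norm_unitary[OF U, of "W ?z"] by (simp add: isometry_op_def coisometry_op_def)
    then have "cadjoint W (W ?z) = ?z"
      by (rule cadjoint_apply_eq_of_norm_eq[OF W])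
    then show ?thesis
      by (metis UWz left_inv)
  qed
  have "cadjoint V (W y) = cadjoint U (W (cadjoint V y))" for y
  proof -
    have "W (cadjoint V y) = cadjoint V (U (W y))"
    proof (rule cinner_right_cancel)
      fix x
      have "cinner x (W (cadjoint V y)) = cinner (V (cadjoint W x)) y"
        by (simp add: cinner_cadjoint[OF bV] cinner_cadjoint_left[OF bW])
      also have "\<dots> = cinner x (cadjoint V (U (W y)))"
        unfolding key
        by (simp add: cinner_cadjoint_left[OF bW] cinner_cadjoint_left[OF bU] cinner_cadjoint[OF bV])
      finally show "cinner x (W (cadjoint V y)) = cinner x (cadjoint V (U (W y)))" .
    qed
    also have "\<dots> = U (cadjoint V (W y))"
      by (rule cadjoint_commute_unitary[OF U bV VU])
    finally show ?thesis
      by (simp add: left_inv)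
  qed
  then show ?thesis
    using tw by (auto simp: doubly_twisted_wrt_def)
qed

theorem corollary5p4:
  fixes V W :: "'a::complex_hilbert \<Rightarrow> 'a"
  assumes "separable_space (euclidean :: 'a topology)"
    and "isometry_op V"
    and "coisometry_op W"
    and "twisted V W"
  shows "doubly_twisted V W"
  using assms twisted_wrt_imp_doubly_twisted_wrt
  unfolding twisted_def doubly_twisted_def by blast

end
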